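(* Let $\mathcal{X}_k\subset\mathbb{R}^n$ be compact, and let $\mathcal{P}_{\mathcal{X}_k}$ be the set of all Borel probability measures $P$ on $\mathbb{R}^n$ with $P(\mathcal{X}_k)=1$. Let $\Omega_1\subseteq\mathbb{R}^n$ be the convex set defined by $$\Omega_1=\arg\inf_{\Omega\subseteq\mathbb{R}^n,\ \Omega\text{ convex}}\ \int_{\Omega}d\mathbf{x}\quad\text{s.t.}\quad \int_{\Omega}dP(\mathbf{x})=1\ \ \text{for all }P\in\mathcal{P}_{\mathcal{X}_k}.$$ Then $\Omega_1=\mathcal{M}$, where $$\mathcal{M}=\left\{\int_{\mathcal{X}_k}\mathbf{x}\,dP(\mathbf{x}):\ P\in\mathcal{P}_{\mathcal{X}_k}\right\}.$$
   Context: $\int_\Omega d\mathbf{x}$ is the Lebesgue measure (volume) of $\Omega$. The notation $\Omega_1=\arg\inf$ means that $\Omega_1$ is the (unique) minimizer of the stated problem, i.e. the minimum-volume convex set having probability one under every $P\in\mathcal{P}_{\mathcal{X}_k}$. *)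

theory Defs
  imports "HOL-Probability.Probability"
begin

definition prob_measures_on :: "(real ^ 'n) set \<Rightarrow> (real ^ 'n) measure set" where
  "prob_measures_on X = {P. prob_space P \<and> sets P = sets borel \<and> measure P X = 1}"

text \<open>
  A convex set need not be Borel, so the mass of \<open>\<Omega>\<close> under \<open>P\<close> is taken in the completion of \<open>P\<close>;
  on Borel sets this is just the mass under \<open>P\<close>. Sets outside the completed sigma-algebra have
  \<^const>\<open>measure\<close> zero and are therefore not feasible.
\<close>

definition feasible :: "(real ^ 'n) set \<Rightarrow> (real ^ 'n) set \<Rightarrow> bool" where
  "feasible X \<Omega> \<longleftrightarrow> convex \<Omega> \<and> (\<forall>P\<in>prob_measures_on X. measure (completion P) \<Omega> = 1)"

text \<open>
  The volume is \<^typ>\<open>ennreal\<close>-valued, since feasible sets may be unbounded. Every convex set is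
  Lebesgue measurable, so the default value of \<^const>\<open>emeasure\<close> off the sigma-algebra plays no role.
\<close>

definition volume_minimizers :: "(real ^ 'n) set \<Rightarrow> (real ^ 'n) set set" where
  "volume_minimizers X = {\<Omega>. is_arg_min (emeasure lebesgue) (feasible X) \<Omega>}"

definition mean_set :: "(real ^ 'n) set \<Rightarrow> (real ^ 'n) set" where
  "mean_set X = {(LINT x:X|P. x) | P. P \<in> prob_measures_on X}"

end

theory Submission
  imports Defs
begin

text \<open>
  Dirac measures force every feasible set to contain \<open>X\<close>, hence its convex hull, which is compact
  and therefore feasible itself; so the hull is a minimizer. It coincides with the set of means:
  finitely supported measures realize all convex combinations, and a mean outside the hull would
  contradict the separation of a point from a closed convex set.
\<close>

text \<open>A convex set differs from its open interior only by points of its frontier, which is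
  negligible. This supplies the measurability that monotonicity of volume asks of a feasible
  set.\<close>

lemma convex_imp_sets_lebesgue:
  fixes S :: "'a::euclidean_space set"
  assumes "convex S"
  shows "S \<in> sets lebesgue"
proof -
  have "negligible (S - interior S)"
    by (rule negligible_subset[OF negligible_convex_frontier[OF assms]])
      (use closure_subset in \<open>auto simp: frontier_def\<close>)
  then have "S - interior S \<in> sets lebesgue"
    by (rule negligible_imp_sets)
  moreover have "interior S \<in> sets lebesgue"
    by simp
  ultimately have "interior S \<union> (S - interior S) \<in> sets lebesgue"
    by (rule sets.Un[rotated])
  then show ?thesis
    using interior_subset[of S] by (simp add: Un_absorb1)
qed

lemma return_in_prob_measures_on:
  assumes "compact X" "x \<in> X"
  shows "return borel x \<in> prob_measures_on X"
proof -
  have "X \<in> sets borel"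
    using assms(1) by (simp add: borel_compact)
  then show ?thesis
    using assms(2) by (simp add: prob_measures_on_def prob_space_return measure_return)
qed

lemma feasible_imp_superset:
  assumes "compact X" "feasible X \<Omega>"
  shows "X \<subseteq> \<Omega>"
proof
  fix x assume "x \<in> X"
  let ?M = "return borel x"
  interpret prob_space ?M
    by (rule prob_space_return) simp
  interpret C: prob_space "completion ?M"
    by (rule prob_space_completion)
  have one: "measure (completion ?M) \<Omega> = 1"
    using assms return_in_prob_measures_on[OF assms(1) \<open>x \<in> X\<close>] by (auto simp: feasible_def)
  show "x \<in> \<Omega>"
  proof (rule ccontr)
    assume "x \<notin> \<Omega>"
    \<comment> \<open>Monotonicity asks measurability only of the larger set, so
      \<open>\<Omega>\<close>, which may fail to be Borel, is compared with the open set
      \<open>- {x}\<close>, a null set of the Dirac measure.\<close>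
    then have "measure (completion ?M) \<Omega> \<le> measure (completion ?M) (- {x})"
      by (intro C.finite_measure_mono) auto
    also have "\<dots> = 0"
      by (simp add: measure_return)
    finally show False
      using one by simp
  qed
qed

lemma feasible_convex_hull:
  assumes "compact X"
  shows "feasible X (convex hull X)"
  unfolding feasible_def
proof (intro conjI ballI convex_convex_hull)
  fix P assume "P \<in> prob_measures_on X"
  then have "prob_space P" and sets: "sets P = sets borel" and one: "measure P X = 1"
    by (auto simp: prob_measures_on_def)
  then interpret prob_space P
    by simp
  \<comment> \<open>The hull of a compact set in finite dimension is compact, hence Borel, and on
    Borel sets the completion agrees with \<open>P\<close>.\<close>
  have hull: "convex hull X \<in> sets P"
    using assms by (simp add: sets borel_compact compact_convex_hull)
  have "measure P X \<le> measure P (convex hull X)"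
    by (intro finite_measure_mono hull hull_subset)
  then show "measure (completion P) (convex hull X) = 1"
    using hull one prob_le_1[of "convex hull X"] by simp
qed

text \<open>The hull is the least feasible set under inclusion, so its volume is least as
  well.\<close>

lemma convex_hull_in_volume_minimizers:
  assumes "compact X"
  shows "convex hull X \<in> volume_minimizers X"
proof -
  have "emeasure lebesgue (convex hull X) \<le> emeasure lebesgue \<Omega>" if "feasible X \<Omega>" for \<Omega>
  proof (rule emeasure_mono)
    have "convex \<Omega>"
      using that by (simp add: feasible_def)
    then show "convex hull X \<subseteq> \<Omega>" "\<Omega> \<in> sets lebesgue"
      using feasible_imp_superset[OF assms that]
      by (auto intro: convex_imp_sets_lebesgue dest: hull_minimal)
  qed
  then show ?thesis
    using feasible_convex_hull[OF assms]
    by (auto simp: volume_minimizers_def is_arg_min_def not_less)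
qed

lemma mean_set_subset_convex_hull:
  assumes "compact X"
  shows "mean_set X \<subseteq> convex hull X"
proof
  fix m assume "m \<in> mean_set X"
  then obtain P where "prob_space P" and sets: "sets P = sets borel" and one: "measure P X = 1"
    and m: "m = (LINT x:X|P. x)"
    by (auto simp: prob_measures_on_def mean_set_def)
  then interpret prob_space P
    by simp
  have X: "X \<in> sets P"
    using assms by (simp add: sets borel_compact)
  have AE: "AE x in P. x \<in> X"
    using one X by (simp add: prob_eq_1)
  \<comment> \<open>Boundedness of \<open>X\<close> bounds the integrand by a constant almost
    everywhere.\<close>
  have int: "integrable P (\<lambda>x. indicator X x *\<^sub>R x)"
  proof -
    obtain B where B: "\<And>x. x \<in> X \<Longrightarrow> norm x \<le> B"
      using compact_imp_bounded[OF assms] by (auto simp: bounded_iff)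
    have [measurable]: "(\<lambda>x. x) \<in> borel_measurable P" "X \<in> sets P"
      using sets X by (auto simp: measurable_ident_sets)
    show ?thesis
    proof (rule integrable_const_bound[of _ B])
      show "AE x in P. norm (indicator X x *\<^sub>R x) \<le> B"
        using AE by eventually_elim (simp add: B)
    qed measurable
  qed
  show "m \<in> convex hull X"
  proof (rule ccontr)
    assume "m \<notin> convex hull X"
    then obtain a b where ab: "a \<bullet> m < b" "\<And>x. x \<in> convex hull X \<Longrightarrow> b < a \<bullet> x"
      using separating_hyperplane_closed_point[of "convex hull X" m] assms
      by (auto simp: compact_convex_hull compact_imp_closed)
    \<comment> \<open>Integration keeps only a weak form of the bound by \<open>b\<close>; this
      suffices because \<open>a \<bullet> m\<close> lies strictly below \<open>b\<close>.\<close>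
    have "b \<le> expectation (\<lambda>x. a \<bullet> (indicator X x *\<^sub>R x))"
    proof (rule integral_ge_const)
      show "integrable P (\<lambda>x. a \<bullet> (indicator X x *\<^sub>R x))"
        by (rule integrable_inner_right) (rule int)
      show "AE x in P. b \<le> a \<bullet> (indicator X x *\<^sub>R x)"
        using AE by eventually_elim (simp add: ab(2) hull_inc less_imp_le)
    qed
    also have "\<dots> = a \<bullet> m"
      unfolding m set_lebesgue_integral_def by (rule integral_inner_right) (rule int)
    finally show False
      using ab(1) by simp
  qed
qed

lemma convex_hull_subset_mean_set:
  assumes "compact X"
  shows "convex hull X \<subseteq> mean_set X"
proof
  fix y assume "y \<in> convex hull X"
  then obtain S u where S: "finite S" "S \<subseteq> X" "\<And>x. x \<in> S \<Longrightarrow> 0 \<le> u x" "sum u S = 1"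
    and y: "(\<Sum>v\<in>S. u v *\<^sub>R v) = y"
    unfolding convex_hull_explicit by blast
  \<comment> \<open>\<open>u\<close> is unconstrained outside \<open>S\<close>, whereas a mass
    function must be nonnegative everywhere with total mass 1; hence the extension by zero.\<close>
  define w where "w x = (if x \<in> S then u x else 0)" for x
  have w_nonneg: "0 \<le> w x" for x
    using S(3) by (simp add: w_def)
  have "(\<integral>\<^sup>+x. ennreal (w x) \<partial>count_space UNIV) = (\<Sum>x\<in>S. ennreal (w x))"
    using S(1) by (intro nn_integral_count_space') (auto simp: w_def)
  also have "\<dots> = ennreal (\<Sum>x\<in>S. w x)"
    by (simp add: w_nonneg sum_ennreal)
  also have "(\<Sum>x\<in>S. w x) = 1"
    using S(4) by (simp add: w_def)
  finally have w_one: "(\<integral>\<^sup>+x. ennreal (w x) \<partial>count_space UNIV) = 1"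
    by simp
  define p where "p = embed_pmf w"
  have pmf: "pmf p x = w x" for x
    unfolding p_def by (rule pmf_embed_pmf[OF w_nonneg w_one])
  have set_p: "set_pmf p \<subseteq> S"
    by (auto simp: set_pmf_eq pmf w_def split: if_splits)
  \<comment> \<open>The measure of a pmf lives on the discrete sigma-algebra. Pushing it forward
    along the identity restricts it to the Borel sets, as \<open>prob_measures_on\<close>
    demands.\<close>
  define P where "P = distr (measure_pmf p) borel (\<lambda>x. x)"
  have X: "X \<in> sets borel"
    using assms by (simp add: borel_compact)
  have "prob_space P"
    unfolding P_def by (rule measure_pmf.prob_space_distr) simp
  moreover have "measure P X = 1"
  proof -
    have "measure P X = measure (measure_pmf p) X"
      unfolding P_def using X by (subst measure_distr) auto
    also have "\<dots> = 1"
      using set_p S(2) by (subst measure_pmf.prob_eq_1) (auto simp: AE_measure_pmf_iff)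
    finally show ?thesis .
  qed
  ultimately have "P \<in> prob_measures_on X"
    by (simp add: prob_measures_on_def P_def)
  moreover have "(LINT x:X|P. x) = y"
  proof -
    have "(LINT x:X|P. x) = (LINT x|measure_pmf p. indicator X x *\<^sub>R x)"
      unfolding P_def set_lebesgue_integral_def using X by (subst integral_distr) auto
    also have "\<dots> = (\<Sum>x\<in>S. pmf p x *\<^sub>R (indicator X x *\<^sub>R x))"
      using set_p S(1) by (intro integral_measure_pmf) auto
    also have "\<dots> = (\<Sum>x\<in>S. u x *\<^sub>R x)"
      using S(2) by (intro sum.cong) (auto simp: pmf w_def)
    finally show ?thesis
      using y by simp
  qed
  ultimately show "y \<in> mean_set X"
    unfolding mean_set_def by blast
qed

theorem theorem3:
  fixes X \<Omega>\<^sub>1 :: "(real ^ 'n) set"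
  assumes "compact X"
    and "volume_minimizers X = {\<Omega>\<^sub>1}"
  shows "\<Omega>\<^sub>1 = mean_set X"
proof -
  \<comment> \<open>Uniqueness of the minimizer turns membership of the hull into equality. A hull
    of volume zero can have rival minimizers, such as a segment through a single point in the
    plane.\<close>
  have "\<Omega>\<^sub>1 = convex hull X"
    using convex_hull_in_volume_minimizers[OF assms(1)] assms(2) by simp
  also have "\<dots> = mean_set X"
    using convex_hull_subset_mean_set[OF assms(1)] mean_set_subset_convex_hull[OF assms(1)]
    by (rule subset_antisym)
  finally show ?thesis .
qed

end
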